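(* Let $\Gamma$ be a finite simple vertex-transitive directed graph that is neither complete nor cocomplete. Then $\Gamma$ is isomorphic to a non-trivial wreath product of directed graphs if and only if $\Gamma$ has a non-trivial bihomogeneous set.
   Context: A simple digraph $\Gamma$ is a finite vertex set $V(\Gamma)$ together with an anti-reflexive relation $E(\Gamma)$ on it; $xy$ is an edge if $(x,y)\in E(\Gamma)$. It is complete if $(x,y)\in E(\Gamma)$ for all $x\ne y$, and cocomplete if $E(\Gamma)=\emptyset$. It is vertex-transitive if some group acts transitively on $V(\Gamma)$ with each group element preserving (directed) edges. A set $H\subseteq V(\Gamma)$ is in-homogeneous if for every $v\in V(\Gamma)\setminus H$, either $vh$ is an edge for all $h\in H$ or $vh$ is not an edge for all $h\in H$; it is out-homogeneous if for every $v\in V(\Gamma)\setminus H$, either $hv$ is an edge for all $h\in H$ or $hv$ is not an edge for all $h\in H$; it is bihomogeneous if it is both. A bihomogeneous set is non-trivial if it contains at least two vertices and is not all of $V(\Gamma)$. The wreath product $\Delta\cdot\Delta'$ of digraphs has vertex set $V(\Delta)\times V(\Delta')$, with an edge from $(x,y)$ to $(x',y')$ iff either $xx'$ is an edge of $\Delta$, or $x=x'$ and $yy'$ is an edge of $\Delta'$; it is non-trivial if both $\Delta$ and $\Delta'$ have at least two vertices. *)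

theory Defs
  imports
    "HOL-Algebra.Group_Action"
    "Graph_Theory.Pair_Digraph"
    "Graph_Theory.Digraph_Isomorphism"
    "Graph_Theory.Kuratowski"
begin

text \<open>
  Finite simple digraphs are the \<open>pair_digraph\<close>s of the library: a finite vertex set
  \<open>pverts\<close> together with an irreflexive relation \<open>parcs\<close> on it.
\<close>

text \<open>
  The group is an explicit parameter. As a hypothesis of a theorem, with \<open>A\<close>, \<open>\<phi>\<close> and the type
  of group elements universally quantified, this says that some group, of whatever type,
  acts vertex-transitively.
\<close>

definition acts_vertex_transitively ::
    "('g, 'm) monoid_scheme \<Rightarrow> ('g \<Rightarrow> 'a \<Rightarrow> 'a) \<Rightarrow> 'a pair_pre_digraph \<Rightarrow> bool" where
  "acts_vertex_transitively A \<phi> \<Gamma> \<longleftrightarrow>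
     transitive_action A (pverts \<Gamma>) \<phi> \<and>
     (\<forall>g\<in>carrier A. \<forall>x y. (x, y) \<in> parcs \<Gamma> \<longrightarrow> (\<phi> g x, \<phi> g y) \<in> parcs \<Gamma>)"

definition cocomplete :: "'a pair_pre_digraph \<Rightarrow> bool" where
  "cocomplete \<Gamma> \<longleftrightarrow> parcs \<Gamma> = {}"

definition in_homogeneous :: "'a pair_pre_digraph \<Rightarrow> 'a set \<Rightarrow> bool" where
  "in_homogeneous \<Gamma> H \<longleftrightarrow> H \<subseteq> pverts \<Gamma> \<and>
     (\<forall>v\<in>pverts \<Gamma> - H. (\<forall>h\<in>H. (v, h) \<in> parcs \<Gamma>) \<or> (\<forall>h\<in>H. (v, h) \<notin> parcs \<Gamma>))"

definition out_homogeneous :: "'a pair_pre_digraph \<Rightarrow> 'a set \<Rightarrow> bool" where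
  "out_homogeneous \<Gamma> H \<longleftrightarrow> H \<subseteq> pverts \<Gamma> \<and>
     (\<forall>v\<in>pverts \<Gamma> - H. (\<forall>h\<in>H. (h, v) \<in> parcs \<Gamma>) \<or> (\<forall>h\<in>H. (h, v) \<notin> parcs \<Gamma>))"

definition bihomogeneous :: "'a pair_pre_digraph \<Rightarrow> 'a set \<Rightarrow> bool" where
  "bihomogeneous \<Gamma> H \<longleftrightarrow> in_homogeneous \<Gamma> H \<and> out_homogeneous \<Gamma> H"

definition nontrivial_bihomogeneous :: "'a pair_pre_digraph \<Rightarrow> 'a set \<Rightarrow> bool" where
  "nontrivial_bihomogeneous \<Gamma> H \<longleftrightarrow> bihomogeneous \<Gamma> H \<and> card H \<ge> 2 \<and> H \<noteq> pverts \<Gamma>"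

definition wreath ::
    "'a pair_pre_digraph \<Rightarrow> 'b pair_pre_digraph \<Rightarrow> ('a \<times> 'b) pair_pre_digraph" where
  "wreath \<Delta> \<Delta>' =
     \<lparr> pverts = pverts \<Delta> \<times> pverts \<Delta>',
       parcs = {((x, y), (x', y')).
         (x, y) \<in> pverts \<Delta> \<times> pverts \<Delta>' \<and> (x', y') \<in> pverts \<Delta> \<times> pverts \<Delta>' \<and>
         ((x, x') \<in> parcs \<Delta> \<or> x = x' \<and> (y, y') \<in> parcs \<Delta>')} \<rparr>"

lemma pair_digraph_wreath:
  assumes "pair_digraph \<Delta>" "pair_digraph \<Delta>'"
  shows "pair_digraph (wreath \<Delta> \<Delta>')"
proof -
  interpret A: pair_digraph \<Delta> by fact
  interpret B: pair_digraph \<Delta>' by fact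
  have fin: "finite (pverts \<Delta> \<times> pverts \<Delta>')"
    using A.pair_finite_verts B.pair_finite_verts by simp
  have "parcs (wreath \<Delta> \<Delta>') \<subseteq> (pverts \<Delta> \<times> pverts \<Delta>') \<times> (pverts \<Delta> \<times> pverts \<Delta>')"
    by (auto simp: wreath_def)
  then have "finite (parcs (wreath \<Delta> \<Delta>'))"
    using fin finite_subset by blast
  with fin show ?thesis
    using A.no_loops' B.no_loops' by unfold_locales (auto simp: wreath_def)
qed

text \<open>
  HOL cannot quantify existentially over the vertex types of the two factors. Since finite
  digraphs have isomorphic copies on natural numbers, ranging over factors with vertices in
  \<^typ>\<open>nat\<close> loses no generality; see \<open>isomorphic_to_nontrivial_wreathI\<close> below.
\<close>

definition isomorphic_to_nontrivial_wreath :: "'a pair_pre_digraph \<Rightarrow> bool" where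
  "isomorphic_to_nontrivial_wreath \<Gamma> \<longleftrightarrow>
     (\<exists>(\<Delta> :: nat pair_pre_digraph) (\<Delta>' :: nat pair_pre_digraph).
        pair_digraph \<Delta> \<and> pair_digraph \<Delta>' \<and> card (pverts \<Delta>) \<ge> 2 \<and> card (pverts \<Delta>') \<ge> 2 \<and>
        digraph_iso (with_proj \<Gamma>) (with_proj (wreath \<Delta> \<Delta>')))"

lemma digraph_iso_with_proj_iff:
  "digraph_iso (with_proj G) (with_proj H) \<longleftrightarrow>
     pair_wf_digraph G \<and>
     (\<exists>f. bij_betw f (pverts G) (pverts H) \<and> parcs H = (\<lambda>(x, y). (f x, f y)) ` parcs G)"
  (is "?L \<longleftrightarrow> ?R")
proof
  assume ?L
  then obtain h where h: "pre_digraph.digraph_isomorphism (with_proj G) h"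
    and H: "with_proj H = app_iso h (with_proj G)"
    unfolding digraph_iso_def by blast
  from H have eqs: "pverts H = iso_verts h ` pverts G" "parcs H = iso_arcs h ` parcs G"
    "fst = iso_tail h" "snd = iso_head h"
    unfolding with_proj_def app_iso_def by auto
  have arcs: "iso_arcs h a = (iso_verts h (fst a), iso_verts h (snd a))" if "a \<in> parcs G" for a
    using h that
    by (simp add: pre_digraph.digraph_isomorphism_def eqs(3,4)[symmetric] prod_eq_iff)
  have "bij_betw (iso_verts h) (pverts G) (pverts H)"
    using h eqs(1) by (simp add: pre_digraph.digraph_isomorphism_def bij_betw_def)
  moreover have "parcs H = (\<lambda>(x, y). (iso_verts h x, iso_verts h y)) ` parcs G"
    unfolding eqs(2) using arcs by (intro image_cong) auto
  moreover have "pair_wf_digraph G"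
    using h by (simp add: pre_digraph.digraph_isomorphism_def wf_digraph_wp_iff)
  ultimately show ?R by blast
next
  assume ?R
  then obtain f where wf: "pair_wf_digraph G" and f: "bij_betw f (pverts G) (pverts H)"
    and arcs: "parcs H = (\<lambda>(x, y). (f x, f y)) ` parcs G" by blast
  interpret pair_wf_digraph G by fact
  let ?h = "\<lparr> iso_verts = f, iso_arcs = \<lambda>(x, y). (f x, f y), iso_head = snd, iso_tail = fst \<rparr>"
  have "inj_on (\<lambda>(x, y). (f x, f y)) (parcs G)"
  proof (rule inj_onI, clarify)
    fix x y x' y'
    assume "(x, y) \<in> parcs G" "(x', y') \<in> parcs G" "f x = f x'" "f y = f y'"
    then show "x = x' \<and> y = y'"
      using f in_arcsD1 in_arcsD2 unfolding bij_betw_def by (meson inj_onD)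
  qed
  then have "pre_digraph.digraph_isomorphism (with_proj G) ?h"
    using wf f by (auto simp: pre_digraph.digraph_isomorphism_def wf_digraph_wp_iff bij_betw_def)
  moreover have "with_proj H = app_iso ?h (with_proj G)"
    using f arcs by (simp add: with_proj_def app_iso_def bij_betw_def)
  ultimately show ?L unfolding digraph_iso_def by blast
qed

lemma pair_digraph_nat_copy:
  fixes \<Delta> :: "'b pair_pre_digraph"
  assumes "pair_digraph \<Delta>"
  obtains f :: "'b \<Rightarrow> nat" and \<Delta>N :: "nat pair_pre_digraph" where
    "pair_digraph \<Delta>N" "bij_betw f (pverts \<Delta>) (pverts \<Delta>N)"
    "parcs \<Delta>N = (\<lambda>(x, y). (f x, f y)) ` parcs \<Delta>"
proof -
  interpret pair_digraph \<Delta> by fact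
  obtain f :: "'b \<Rightarrow> nat" where f: "inj_on f (pverts \<Delta>)"
    using pair_finite_verts finite_imp_inj_to_nat_seg by blast
  define N where "N = \<lparr> pverts = f ` pverts \<Delta>, parcs = (\<lambda>(x, y). (f x, f y)) ` parcs \<Delta> \<rparr>"
  have "pair_digraph N"
  proof (unfold_locales, goal_cases)
    case (5 e)
    then obtain x y where "(x, y) \<in> parcs \<Delta>" "e = (f x, f y)" by (auto simp: N_def)
    then show ?case
      using f in_arcsD1 in_arcsD2 no_loops' by (simp add: inj_on_eq_iff)
  qed (use pair_finite_verts pair_finite_arcs in_arcsD1 in_arcsD2 in \<open>auto simp: N_def\<close>)
  with f show ?thesis
    by (intro that[of N f]) (auto simp: N_def bij_betw_def)
qed

lemma isomorphic_to_nontrivial_wreathI: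
  fixes \<Gamma> :: "'a pair_pre_digraph" and \<Delta> :: "'b pair_pre_digraph" and \<Delta>' :: "'c pair_pre_digraph"
  assumes "pair_digraph \<Delta>" "pair_digraph \<Delta>'" "card (pverts \<Delta>) \<ge> 2" "card (pverts \<Delta>') \<ge> 2"
    and iso: "digraph_iso (with_proj \<Gamma>) (with_proj (wreath \<Delta> \<Delta>'))"
  shows "isomorphic_to_nontrivial_wreath \<Gamma>"
proof -
  interpret A: pair_digraph \<Delta> by fact
  interpret B: pair_digraph \<Delta>' by fact
  interpret W: pair_digraph "wreath \<Delta> \<Delta>'" using assms pair_digraph_wreath by blast
  obtain f and N :: "nat pair_pre_digraph" where N: "pair_digraph N"
    "bij_betw f (pverts \<Delta>) (pverts N)" "parcs N = (\<lambda>(x, y). (f x, f y)) ` parcs \<Delta>"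
    by (rule pair_digraph_nat_copy[OF assms(1)])
  obtain g and M :: "nat pair_pre_digraph" where M: "pair_digraph M"
    "bij_betw g (pverts \<Delta>') (pverts M)" "parcs M = (\<lambda>(x, y). (g x, g y)) ` parcs \<Delta>'"
    by (rule pair_digraph_nat_copy[OF assms(2)])
  have f: "(f x, f x') \<in> parcs N \<longleftrightarrow> (x, x') \<in> parcs \<Delta>"
    if "x \<in> pverts \<Delta>" "x' \<in> pverts \<Delta>" for x x'
  proof
    assume "(f x, f x') \<in> parcs N"
    then obtain z z' where z: "(z, z') \<in> parcs \<Delta>" "f x = f z" "f x' = f z'"
      unfolding N(3) by auto
    then have "z = x" "z' = x'"
      using N(2) that A.in_arcsD1 A.in_arcsD2 unfolding bij_betw_def by (metis inj_onD)+
    with z show "(x, x') \<in> parcs \<Delta>" by simp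
  next
    assume "(x, x') \<in> parcs \<Delta>"
    then show "(f x, f x') \<in> parcs N" unfolding N(3) by (intro rev_image_eqI) auto
  qed
  have g: "(g x, g x') \<in> parcs M \<longleftrightarrow> (x, x') \<in> parcs \<Delta>'"
    if "x \<in> pverts \<Delta>'" "x' \<in> pverts \<Delta>'" for x x'
  proof
    assume "(g x, g x') \<in> parcs M"
    then obtain z z' where z: "(z, z') \<in> parcs \<Delta>'" "g x = g z" "g x' = g z'"
      unfolding M(3) by auto
    then have "z = x" "z' = x'"
      using M(2) that B.in_arcsD1 B.in_arcsD2 unfolding bij_betw_def by (metis inj_onD)+
    with z show "(x, x') \<in> parcs \<Delta>'" by simp
  next
    assume "(x, x') \<in> parcs \<Delta>'"
    then show "(g x, g x') \<in> parcs M" unfolding M(3) by (intro rev_image_eqI) auto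
  qed
  have vN: "pverts N = f ` pverts \<Delta>" and vM: "pverts M = g ` pverts \<Delta>'"
    using N(2) M(2) by (simp_all add: bij_betw_def)
  have fi: "f x = f x' \<longleftrightarrow> x = x'" if "x \<in> pverts \<Delta>" "x' \<in> pverts \<Delta>" for x x'
    using N(2) that unfolding bij_betw_def by (meson inj_onD)
  let ?k = "map_prod f g"
  have "bij_betw ?k (pverts (wreath \<Delta> \<Delta>')) (pverts (wreath N M))"
    using N(2) M(2) by (simp add: wreath_def bij_betw_def map_prod_inj_on map_prod_surj_on)
  moreover have "parcs (wreath N M) = (\<lambda>(p, q). (?k p, ?k q)) ` parcs (wreath \<Delta> \<Delta>')" (is "?P = ?Q")
  proof
    show "?Q \<subseteq> ?P" by (auto simp: wreath_def vN vM f g)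
    show "?P \<subseteq> ?Q"
    proof
      fix e assume "e \<in> ?P"
      then obtain x y x' y' where *: "x \<in> pverts \<Delta>" "x' \<in> pverts \<Delta>" "y \<in> pverts \<Delta>'" "y' \<in> pverts \<Delta>'"
        "e = ((f x, g y), (f x', g y'))"
        "(f x, f x') \<in> parcs N \<or> f x = f x' \<and> (g y, g y') \<in> parcs M"
        by (auto simp: wreath_def vN vM)
      then have "((x, y), (x', y')) \<in> parcs (wreath \<Delta> \<Delta>')"
        using f g fi by (simp add: wreath_def)
      then show "e \<in> ?Q" using *(5) by (force intro: rev_image_eqI)
    qed
  qed
  ultimately have "digraph_iso (with_proj (wreath \<Delta> \<Delta>')) (with_proj (wreath N M))"
    using W.pair_wf_digraph by (auto simp: digraph_iso_with_proj_iff)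
  then have "digraph_iso (with_proj \<Gamma>) (with_proj (wreath N M))"
    using iso digraph_iso_trans by blast
  moreover have "card (pverts N) \<ge> 2" "card (pverts M) \<ge> 2"
    using assms N(2) M(2) by (metis bij_betw_same_card)+
  ultimately show ?thesis
    unfolding isomorphic_to_nontrivial_wreath_def using N(1) M(1) by blast
qed

end

theory Submission
  imports Defs
begin

text \<open>
  Fibres of a wreath product over its first factor are bihomogeneous. Conversely, it suffices to
  find a non-trivial bihomogeneous set whose translates under automorphisms are pairwise equal or
  disjoint: they then are the vertices of the first factor. A bihomogeneous set of minimal size
  \<open>\<ge> 2\<close> works unless two of its translates overlap; in that case intersections and differences of
  overlapping bihomogeneous sets being bihomogeneous, minimality forces size two. The two elements
  of a bihomogeneous pair are joined by both edges or by none, as the out-degree is constant, so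
  they are twins; the classes of twins are then as desired, unless \<open>\<Gamma>\<close> is complete or cocomplete.
\<close>

section \<open>Closure properties of bihomogeneous sets\<close>

lemma bihomogeneous_iff:
  "bihomogeneous \<Gamma> H \<longleftrightarrow> H \<subseteq> pverts \<Gamma> \<and>
     (\<forall>v\<in>pverts \<Gamma> - H. \<forall>h\<in>H. \<forall>h'\<in>H.
        ((v, h) \<in> parcs \<Gamma> \<longleftrightarrow> (v, h') \<in> parcs \<Gamma>) \<and> ((h, v) \<in> parcs \<Gamma> \<longleftrightarrow> (h', v) \<in> parcs \<Gamma>))"
  unfolding bihomogeneous_def in_homogeneous_def out_homogeneous_def by blast

lemma bihomogeneousD:
  assumes "bihomogeneous \<Gamma> H" "v \<in> pverts \<Gamma>" "v \<notin> H" "h \<in> H" "h' \<in> H"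
  shows "(v, h) \<in> parcs \<Gamma> \<longleftrightarrow> (v, h') \<in> parcs \<Gamma>"
    and "(h, v) \<in> parcs \<Gamma> \<longleftrightarrow> (h', v) \<in> parcs \<Gamma>"
  using assms unfolding bihomogeneous_iff by blast+

lemma bihomogeneous_Int:
  assumes "bihomogeneous \<Gamma> X" "bihomogeneous \<Gamma> Y"
  shows "bihomogeneous \<Gamma> (X \<inter> Y)"
  using assms unfolding bihomogeneous_iff by blast

text \<open>The delicate vertices are those common to \<open>X\<close> and \<open>Y\<close>, about
  which \<open>X\<close> says nothing. The last assumption provides a substitute for them; without
  it, removing one vertex from the whole vertex set would in general be a counterexample.\<close>

lemma bihomogeneous_Diff:
  assumes X: "bihomogeneous \<Gamma> X" and Y: "bihomogeneous \<Gamma> Y" and "\<not> Y \<subseteq> X"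
  shows "bihomogeneous \<Gamma> (X - Y)"
proof -
  obtain w where w: "w \<in> Y" "w \<notin> X" using assms by blast
  have sub: "X \<subseteq> pverts \<Gamma>" "Y \<subseteq> pverts \<Gamma>" using X Y by (auto simp: bihomogeneous_iff)
  show ?thesis unfolding bihomogeneous_iff
  proof (intro conjI ballI)
    show "X - Y \<subseteq> pverts \<Gamma>" using sub by blast
  next
    fix v h h' assume v: "v \<in> pverts \<Gamma> - (X - Y)" and h: "h \<in> X - Y" "h' \<in> X - Y"
    have "((v, h) \<in> parcs \<Gamma> \<longleftrightarrow> (v, h') \<in> parcs \<Gamma>) \<and> ((h, v) \<in> parcs \<Gamma> \<longleftrightarrow> (h', v) \<in> parcs \<Gamma>)"
    proof (cases "v \<in> X")
      case True
      \<comment> \<open>Then \<open>v \<in> Y\<close>, and \<open>v\<close> may be replaced by \<open>w\<close>, which lies outside \<open>X\<close>.\<close>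
      then have "v \<in> Y" using v by blast
      then show ?thesis
        using bihomogeneousD[OF Y, of h v w] bihomogeneousD[OF Y, of h' v w]
          bihomogeneousD[OF X, of w h h'] h w sub by blast
    next
      case False
      then show ?thesis using bihomogeneousD[OF X, of v h h'] v h by blast
    qed
    then show "(v, h) \<in> parcs \<Gamma> \<longleftrightarrow> (v, h') \<in> parcs \<Gamma>" "(h, v) \<in> parcs \<Gamma> \<longleftrightarrow> (h', v) \<in> parcs \<Gamma>"
      by blast+
  qed
qed

section \<open>Automorphisms, vertex-transitivity and blocks\<close>

definition automorphism :: "'a pair_pre_digraph \<Rightarrow> ('a \<Rightarrow> 'a) \<Rightarrow> bool" where
  "automorphism \<Gamma> f \<longleftrightarrow> bij_betw f (pverts \<Gamma>) (pverts \<Gamma>) \<and>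
     (\<forall>x\<in>pverts \<Gamma>. \<forall>y\<in>pverts \<Gamma>. (f x, f y) \<in> parcs \<Gamma> \<longleftrightarrow> (x, y) \<in> parcs \<Gamma>)"

text \<open>Only the existence of automorphisms is kept, so that the group and the type of its
  elements disappear from the rest of the proof.\<close>

definition vertex_transitive :: "'a pair_pre_digraph \<Rightarrow> bool" where
  "vertex_transitive \<Gamma> \<longleftrightarrow> (\<forall>x\<in>pverts \<Gamma>. \<forall>y\<in>pverts \<Gamma>. \<exists>f. automorphism \<Gamma> f \<and> f x = y)"

lemma automorphism_arc_iff:
  assumes "automorphism \<Gamma> f" "x \<in> pverts \<Gamma>" "y \<in> pverts \<Gamma>"
  shows "(f x, f y) \<in> parcs \<Gamma> \<longleftrightarrow> (x, y) \<in> parcs \<Gamma>"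
  using assms by (simp add: automorphism_def)

lemma automorphism_image: "automorphism \<Gamma> f \<Longrightarrow> f ` pverts \<Gamma> = pverts \<Gamma>"
  by (simp add: automorphism_def bij_betw_def)

lemma automorphism_inj: "automorphism \<Gamma> f \<Longrightarrow> inj_on f (pverts \<Gamma>)"
  by (simp add: automorphism_def bij_betw_def)

lemma automorphism_closed: "automorphism \<Gamma> f \<Longrightarrow> x \<in> pverts \<Gamma> \<Longrightarrow> f x \<in> pverts \<Gamma>"
  using automorphism_image by blast

text \<open>The action is only assumed to preserve edges; applying the inverse group element shows
  that it also reflects them.\<close>

lemma vertex_transitiveI:
  assumes "pair_digraph \<Gamma>" "acts_vertex_transitively A \<phi> \<Gamma>"
  shows "vertex_transitive \<Gamma>"
proof -
  interpret pair_digraph \<Gamma> by fact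
  interpret transitive_action A "pverts \<Gamma>" \<phi>
    using assms(2) by (simp add: acts_vertex_transitively_def)
  interpret group A using group_hom group_hom.axioms(1) by blast
  have mono: "(\<phi> g x, \<phi> g y) \<in> parcs \<Gamma>" if "g \<in> carrier A" "(x, y) \<in> parcs \<Gamma>" for g x y
    using assms(2) that by (simp add: acts_vertex_transitively_def)
  have "automorphism \<Gamma> (\<phi> g)" if g: "g \<in> carrier A" for g
    unfolding automorphism_def
  proof (intro conjI ballI)
    show "bij_betw (\<phi> g) (pverts \<Gamma>) (pverts \<Gamma>)"
      using g inj_prop surj_prop by (simp add: bij_betw_def)
  next
    fix x y assume "x \<in> pverts \<Gamma>" "y \<in> pverts \<Gamma>"
    then have "\<phi> (inv\<^bsub>A\<^esub> g) (\<phi> g x) = x" "\<phi> (inv\<^bsub>A\<^esub> g) (\<phi> g y) = y"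
      using orbit_sym_aux[OF g] by blast+
    then show "(\<phi> g x, \<phi> g y) \<in> parcs \<Gamma> \<longleftrightarrow> (x, y) \<in> parcs \<Gamma>"
      using mono g inv_closed by metis
  qed
  then show ?thesis unfolding vertex_transitive_def using unique_orbit by blast
qed

lemma bihomogeneous_automorphism_image:
  assumes f: "automorphism \<Gamma> f" and H: "bihomogeneous \<Gamma> H"
  shows "bihomogeneous \<Gamma> (f ` H)"
proof -
  have sub: "H \<subseteq> pverts \<Gamma>" using H by (simp add: bihomogeneous_iff)
  show ?thesis unfolding bihomogeneous_iff
  proof (intro conjI ballI)
    show "f ` H \<subseteq> pverts \<Gamma>" using sub automorphism_closed[OF f] by blast
  next
    fix v k k' assume v: "v \<in> pverts \<Gamma> - f ` H" and k: "k \<in> f ` H" "k' \<in> f ` H"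
    obtain u where u: "u \<in> pverts \<Gamma>" "v = f u" using v automorphism_image[OF f] by blast
    obtain h h' where h: "h \<in> H" "k = f h" "h' \<in> H" "k' = f h'" using k by blast
    have "u \<notin> H" using u v by blast
    note * = bihomogeneousD[OF H u(1) this h(1,3)]
    have V: "h \<in> pverts \<Gamma>" "h' \<in> pverts \<Gamma>" using h sub by auto
    show "(v, k) \<in> parcs \<Gamma> \<longleftrightarrow> (v, k') \<in> parcs \<Gamma>" "(k, v) \<in> parcs \<Gamma> \<longleftrightarrow> (k', v) \<in> parcs \<Gamma>"
      using * u h V by (simp_all add: automorphism_arc_iff[OF f])
  qed
qed

text \<open>The second conjunct is that of a block of imprimitivity for the full automorphism group.
  Comparing two arbitrary translates, instead of one translate with \<open>H\<close>, avoids
  composing and inverting automorphisms.\<close>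

definition bihomogeneous_block :: "'a pair_pre_digraph \<Rightarrow> 'a set \<Rightarrow> bool" where
  "bihomogeneous_block \<Gamma> H \<longleftrightarrow> nontrivial_bihomogeneous \<Gamma> H \<and>
     (\<forall>f g. automorphism \<Gamma> f \<longrightarrow> automorphism \<Gamma> g \<longrightarrow> f ` H = g ` H \<or> f ` H \<inter> g ` H = {})"

section \<open>Out-degrees and bihomogeneous pairs\<close>

lemma vertex_transitive_out_regular:
  assumes "pair_digraph \<Gamma>" "vertex_transitive \<Gamma>" "x \<in> pverts \<Gamma>" "y \<in> pverts \<Gamma>"
  shows "card {z. (x, z) \<in> parcs \<Gamma>} = card {z. (y, z) \<in> parcs \<Gamma>}"
proof -
  interpret pair_digraph \<Gamma> by fact
  obtain f where f: "automorphism \<Gamma> f" "f x = y"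
    using assms unfolding vertex_transitive_def by blast
  have "{z. (y, z) \<in> parcs \<Gamma>} = f ` {z. (x, z) \<in> parcs \<Gamma>}"
  proof (intro equalityI subsetI)
    fix z assume z: "z \<in> {z. (y, z) \<in> parcs \<Gamma>}"
    then obtain u where "u \<in> pverts \<Gamma>" "z = f u"
      using automorphism_image[OF f(1)] in_arcsD2 by blast
    then show "z \<in> f ` {z. (x, z) \<in> parcs \<Gamma>}"
      using z f assms(3) automorphism_arc_iff[OF f(1), of x u] by auto
  next
    fix z assume "z \<in> f ` {z. (x, z) \<in> parcs \<Gamma>}"
    then show "z \<in> {z. (y, z) \<in> parcs \<Gamma>}"
      using f assms(3) in_arcsD2 automorphism_arc_iff[OF f(1), of x] by auto
  qed
  moreover have "inj_on f {z. (x, z) \<in> parcs \<Gamma>}"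
    using automorphism_inj[OF f(1)] by (rule inj_on_subset) (auto dest: in_arcsD2)
  ultimately show ?thesis by (simp add: card_image)
qed

text \<open>Outside the pair, \<open>a\<close> and \<open>b\<close> have the same out-neighbours, so
  an edge in one direction only would give \<open>a\<close> exactly one out-neighbour more than
  \<open>b\<close>.\<close>

lemma bihomogeneous_pair_symmetric:
  assumes G: "pair_digraph \<Gamma>" and vt: "vertex_transitive \<Gamma>" and H: "bihomogeneous \<Gamma> {a, b}"
    and ab: "(a, b) \<in> parcs \<Gamma>"
  shows "(b, a) \<in> parcs \<Gamma>"
proof (rule ccontr)
  assume ba: "(b, a) \<notin> parcs \<Gamma>"
  interpret pair_digraph \<Gamma> by fact
  have V: "a \<in> pverts \<Gamma>" "b \<in> pverts \<Gamma>" using ab in_arcsD1 in_arcsD2 by blast+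
  have loops: "(z, z) \<notin> parcs \<Gamma>" for z using no_loops' by blast
  have "(a, z) \<in> parcs \<Gamma> \<longleftrightarrow> z = b \<or> (b, z) \<in> parcs \<Gamma>" for z
    using bihomogeneousD(2)[OF H, of z a b] ab ba loops in_arcsD2 by blast
  then have "{z. (a, z) \<in> parcs \<Gamma>} = insert b {z. (b, z) \<in> parcs \<Gamma>}" by blast
  moreover have "finite {z. (b, z) \<in> parcs \<Gamma>}"
    by (rule finite_subset[OF _ pair_finite_verts]) (auto dest: in_arcsD2)
  ultimately have "card {z. (a, z) \<in> parcs \<Gamma>} = Suc (card {z. (b, z) \<in> parcs \<Gamma>})"
    using loops by simp
  then show False using vertex_transitive_out_regular[OF G vt V] by simp
qed

section \<open>Twin classes\<close>

text \<open>
  With \<open>R\<close> the edge relation this is equality of open neighbourhoods; adding the identity to \<open>R\<close>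
  turns it into equality of closed neighbourhoods.
\<close>

definition twins :: "'a set \<Rightarrow> ('a \<times> 'a) set \<Rightarrow> 'a \<Rightarrow> 'a set" where
  "twins V R a = {b\<in>V. \<forall>z\<in>V. ((b, z) \<in> R \<longleftrightarrow> (a, z) \<in> R) \<and> ((z, b) \<in> R \<longleftrightarrow> (z, a) \<in> R)}"

text \<open>The relation is arbitrary so that the edge relation and its union with \<open>Id\<close>
  are treated at once.\<close>

lemma twins_image:
  assumes f: "bij_betw f V V" and R: "\<And>x y. x \<in> V \<Longrightarrow> y \<in> V \<Longrightarrow> (f x, f y) \<in> R \<longleftrightarrow> (x, y) \<in> R"
    and a: "a \<in> V"
  shows "f ` twins V R a = twins V R (f a)"
proof -
  have im: "V = f ` V" using f by (simp add: bij_betw_def)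
  have "f b \<in> twins V R (f a) \<longleftrightarrow> b \<in> twins V R a" if b: "b \<in> V" for b
  proof -
    have "f b \<in> twins V R (f a) \<longleftrightarrow>
      (\<forall>z\<in>f ` V. ((f b, z) \<in> R \<longleftrightarrow> (f a, z) \<in> R) \<and> ((z, f b) \<in> R \<longleftrightarrow> (z, f a) \<in> R))"
      unfolding twins_def using b im by auto
    also have "\<dots> \<longleftrightarrow> b \<in> twins V R a" unfolding twins_def using R a b by simp
    finally show ?thesis .
  qed
  note iff = this
  have sub: "twins V R x \<subseteq> V" for x by (auto simp: twins_def)
  show ?thesis
  proof (intro equalityI subsetI)
    fix y assume "y \<in> f ` twins V R a"
    then show "y \<in> twins V R (f a)" using iff sub by blast
  next
    fix y assume y: "y \<in> twins V R (f a)"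
    then obtain b where "b \<in> V" "y = f b" using sub im by blast
    then show "y \<in> f ` twins V R a" using y iff by blast
  qed
qed

text \<open>A common member has the neighbourhoods of both \<open>x\<close> and \<open>y\<close>, so
  these agree.\<close>

lemma twins_eq_or_disjoint: "twins V R x = twins V R y \<or> twins V R x \<inter> twins V R y = {}"
proof (rule disjCI)
  assume "twins V R x \<inter> twins V R y \<noteq> {}"
  then obtain z where "z \<in> twins V R x" "z \<in> twins V R y" by blast
  then show "twins V R x = twins V R y" unfolding twins_def by blast
qed

text \<open>Off the diagonal \<open>R\<close> is the edge relation, so no vertex outside the class
  separates two of its members. Automorphisms preserve \<open>R\<close> and therefore permute the
  twin classes.\<close>

lemma bihomogeneous_block_twins:
  assumes G: "pair_digraph \<Gamma>" and R: "R = parcs \<Gamma> \<or> R = parcs \<Gamma> \<union> Id"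
    and ab: "a \<in> pverts \<Gamma>" "b \<in> twins (pverts \<Gamma>) R a" "a \<noteq> b"
    and nc: "\<not> complete_digraph (card (pverts \<Gamma>)) (with_proj \<Gamma>)" and ncc: "\<not> cocomplete \<Gamma>"
  shows "bihomogeneous_block \<Gamma> (twins (pverts \<Gamma>) R a)" (is "bihomogeneous_block \<Gamma> ?T")
proof -
  interpret pair_digraph \<Gamma> by fact
  have loops: "(z, z) \<notin> parcs \<Gamma>" for z using no_loops' by blast
  have R_arc: "(x, y) \<in> R \<longleftrightarrow> (x, y) \<in> parcs \<Gamma>" if "x \<noteq> y" for x y using R that by blast
  have sub: "?T \<subseteq> pverts \<Gamma>" by (auto simp: twins_def)
  have "bihomogeneous \<Gamma> ?T" unfolding bihomogeneous_iff
  proof (intro conjI ballI)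
    show "?T \<subseteq> pverts \<Gamma>" by fact
  next
    fix v h h' assume v: "v \<in> pverts \<Gamma> - ?T" and h: "h \<in> ?T" "h' \<in> ?T"
    then have "((v, h) \<in> R \<longleftrightarrow> (v, h') \<in> R) \<and> ((h, v) \<in> R \<longleftrightarrow> (h', v) \<in> R)"
      by (simp add: twins_def)
    moreover have "v \<noteq> h" "v \<noteq> h'" using v h by auto
    ultimately show "(v, h) \<in> parcs \<Gamma> \<longleftrightarrow> (v, h') \<in> parcs \<Gamma>"
      "(h, v) \<in> parcs \<Gamma> \<longleftrightarrow> (h', v) \<in> parcs \<Gamma>"
      using R_arc by metis+
  qed
  moreover have "card ?T \<ge> 2"
  proof -
    have "{a, b} \<subseteq> ?T" using ab by (simp add: twins_def)
    then have "card {a, b} \<le> card ?T"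
      using sub pair_finite_verts by (meson card_mono finite_subset)
    then show ?thesis using ab by simp
  qed
  moreover have "?T \<noteq> pverts \<Gamma>"
  proof
    assume T: "?T = pverts \<Gamma>"
    \<comment> \<open>If every vertex is a twin of \<open>a\<close>, then \<open>(x, y)\<close> and
      \<open>(x, x)\<close> both behave like \<open>(x, a)\<close>. So an irreflexive
      \<open>R\<close> is empty and a reflexive one is full on the vertices: the two excluded
      cases.\<close>
    have all: "(x, y) \<in> R \<longleftrightarrow> (x, x) \<in> R" if "x \<in> pverts \<Gamma>" "y \<in> pverts \<Gamma>" for x y
    proof -
      have "x \<in> ?T" "y \<in> ?T" using that T by auto
      then show ?thesis using that by (simp add: twins_def)
    qed
    from R show False
    proof
      assume "R = parcs \<Gamma>"
      then have "e \<notin> parcs \<Gamma>" for e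
        using all[of "fst e" "snd e"] loops in_arcsD1 in_arcsD2 by (cases e) auto
      then have "parcs \<Gamma> = {}" by blast
      then show False using ncc by (simp add: cocomplete_def)
    next
      assume "R = parcs \<Gamma> \<union> Id"
      then have "(x, y) \<in> parcs \<Gamma>" if "x \<in> pverts \<Gamma>" "y \<in> pverts \<Gamma>" "x \<noteq> y" for x y
        using all that by blast
      then have "parcs \<Gamma> = {(u, v). (u, v) \<in> pverts \<Gamma> \<times> pverts \<Gamma> \<and> u \<noteq> v}"
        by (auto simp: loops dest: in_arcsD1 in_arcsD2)
      then show False using nc pair_finite_verts by (simp add: complete_digraph_pair_def)
    qed
  qed
  moreover have "f ` ?T = g ` ?T \<or> f ` ?T \<inter> g ` ?T = {}"
    if fg: "automorphism \<Gamma> f" "automorphism \<Gamma> g" for f g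
  proof -
    have "k ` ?T = twins (pverts \<Gamma>) R (k a)" if k: "automorphism \<Gamma> k" for k
    proof (rule twins_image)
      show "bij_betw k (pverts \<Gamma>) (pverts \<Gamma>)" using k by (simp add: automorphism_def)
    next
      fix x y assume "x \<in> pverts \<Gamma>" "y \<in> pverts \<Gamma>"
      \<comment> \<open>For the summand \<open>Id\<close> this is injectivity of \<open>k\<close> on
        the vertices.\<close>
      then show "(k x, k y) \<in> R \<longleftrightarrow> (x, y) \<in> R"
        using R automorphism_arc_iff[OF k] automorphism_inj[OF k] by (auto dest: inj_onD)
    qed fact
    then show ?thesis using fg twins_eq_or_disjoint by metis
  qed
  ultimately show ?thesis
    by (simp add: bihomogeneous_block_def nontrivial_bihomogeneous_def)
qed

text \<open>Bihomogeneity handles all vertices outside the pair. On the pair itself \<open>R\<close>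
  is chosen to be constant: full if the two are joined, empty if they are not.\<close>

lemma bihomogeneous_pair_twins:
  assumes G: "pair_digraph \<Gamma>" and H: "bihomogeneous \<Gamma> {a, b}"
    and R: "R = (if (a, b) \<in> parcs \<Gamma> then parcs \<Gamma> \<union> Id else parcs \<Gamma>)"
    and sym: "(a, b) \<in> parcs \<Gamma> \<longleftrightarrow> (b, a) \<in> parcs \<Gamma>"
  shows "b \<in> twins (pverts \<Gamma>) R a"
proof -
  interpret pair_digraph \<Gamma> by fact
  have loops: "(z, z) \<notin> parcs \<Gamma>" for z using no_loops' by blast
  have "((b, z) \<in> R \<longleftrightarrow> (a, z) \<in> R) \<and> ((z, b) \<in> R \<longleftrightarrow> (z, a) \<in> R)" if "z \<in> pverts \<Gamma>" for z
  proof (cases "z \<in> {a, b}")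
    case True
    then show ?thesis using R sym loops by auto
  next
    case False
    then show ?thesis using bihomogeneousD[OF H that, of a b] R by auto
  qed
  moreover have "b \<in> pverts \<Gamma>" using H by (simp add: bihomogeneous_iff)
  ultimately show ?thesis by (simp add: twins_def)
qed

section \<open>Existence of a bihomogeneous block\<close>

text \<open>The sets \<open>X \<inter> Y\<close> and \<open>X - Y\<close> are bihomogeneous and
  split \<open>X\<close>; by minimality each has at most one element.\<close>

lemma minimal_bihomogeneous_overlap:
  assumes fin: "finite (pverts \<Gamma>)"
    and X: "bihomogeneous \<Gamma> X" "card X = n" and Y: "bihomogeneous \<Gamma> Y" "card Y = n"
    and neq: "X \<noteq> Y" and meet: "X \<inter> Y \<noteq> {}"
    and min: "\<And>Z. bihomogeneous \<Gamma> Z \<Longrightarrow> Z \<subset> X \<Longrightarrow> card Z < 2"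
  shows "n \<le> 2"
proof -
  have finX: "finite X" and finY: "finite Y"
    using X Y fin by (auto simp: bihomogeneous_iff intro: finite_subset)
  \<comment> \<open>Having equal finite size, distinct sets are incomparable. This makes
    \<open>X \<inter> Y\<close> a proper subset of \<open>X\<close> and allows the difference lemma
    to be applied; \<open>X - Y\<close> is proper because the sets meet.\<close>
  have nsub: "\<not> X \<subseteq> Y" "\<not> Y \<subseteq> X"
    using card_subset_eq[OF finY, of X] card_subset_eq[OF finX, of Y] X Y neq by auto
  have "card (X \<inter> Y) < 2" "card (X - Y) < 2"
    using min[OF bihomogeneous_Int[OF X(1) Y(1)]] min[OF bihomogeneous_Diff[OF X(1) Y(1) nsub(2)]]
      nsub meet by blast+
  moreover have "card X = card (X \<inter> Y) + card (X - Y)"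
    using finX by (metis card_Int_Diff)
  ultimately show ?thesis using X by simp
qed

lemma bihomogeneous_block_exists:
  assumes G: "pair_digraph \<Gamma>" and vt: "vertex_transitive \<Gamma>"
    and nc: "\<not> complete_digraph (card (pverts \<Gamma>)) (with_proj \<Gamma>)" and ncc: "\<not> cocomplete \<Gamma>"
    and ex: "\<exists>H. nontrivial_bihomogeneous \<Gamma> H"
  shows "\<exists>H. bihomogeneous_block \<Gamma> H"
proof -
  interpret pair_digraph \<Gamma> by fact
  obtain H where H: "nontrivial_bihomogeneous \<Gamma> H"
    and min: "\<And>K. nontrivial_bihomogeneous \<Gamma> K \<Longrightarrow> card H \<le> card K"
    using ex arg_min_natI[of "nontrivial_bihomogeneous \<Gamma>" _ card] arg_min_nat_le by metis
  have bi: "bihomogeneous \<Gamma> H" and ge2: "card H \<ge> 2" and neq: "H \<noteq> pverts \<Gamma>"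
    using H by (simp_all add: nontrivial_bihomogeneous_def)
  have sub: "H \<subseteq> pverts \<Gamma>" using bi by (simp add: bihomogeneous_iff)
  show ?thesis
  proof (cases "card H = 2")
    \<comment> \<open>Here \<open>H\<close> itself need not be a block: any two of three twins form
      a bihomogeneous pair, and such pairs overlap. The block is the whole twin class of
      \<open>a\<close>.\<close>
    case True
    then obtain a b where ab: "H = {a, b}" "a \<noteq> b" by (auto simp: card_2_iff)
    have pair: "bihomogeneous \<Gamma> {a, b}" "bihomogeneous \<Gamma> {b, a}"
      using bi ab by (simp_all add: insert_commute)
    have sym: "(a, b) \<in> parcs \<Gamma> \<longleftrightarrow> (b, a) \<in> parcs \<Gamma>"
      using bihomogeneous_pair_symmetric[OF G vt] pair by blast
    have a: "a \<in> pverts \<Gamma>" using sub ab by simp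
    show ?thesis
      by (rule exI, rule bihomogeneous_block_twins[OF G _ a
            bihomogeneous_pair_twins[OF G pair(1) refl sym] ab(2) nc ncc]) simp
  next
    case False
    have "f ` H = g ` H \<or> f ` H \<inter> g ` H = {}"
      if fg: "automorphism \<Gamma> f" "automorphism \<Gamma> g" for f g
    proof (rule ccontr)
      assume "\<not> ?thesis"
      then have ov: "f ` H \<noteq> g ` H" "f ` H \<inter> g ` H \<noteq> {}" by blast+
      have bis: "bihomogeneous \<Gamma> (k ` H)" and cards: "card (k ` H) = card H"
        if "automorphism \<Gamma> k" for k
        using bihomogeneous_automorphism_image[OF that bi] automorphism_inj[OF that] sub
        by (auto intro: card_image inj_on_subset)
      \<comment> \<open>Minimality of \<open>H\<close> is by size among all non-trivial
        bihomogeneous sets, so it also applies to the translate of \<open>H\<close> under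
        \<open>f\<close>, which is equally large.\<close>
      have "card Z < 2" if Z: "bihomogeneous \<Gamma> Z" "Z \<subset> f ` H" for Z
      proof (rule ccontr)
        assume "\<not> card Z < 2"
        moreover have "f ` H \<subseteq> pverts \<Gamma>" using bis[OF fg(1)] by (simp add: bihomogeneous_iff)
        ultimately have "nontrivial_bihomogeneous \<Gamma> Z"
          using Z by (auto simp: nontrivial_bihomogeneous_def)
        moreover have "card Z < card H"
          using psubset_card_mono[OF _ Z(2)] cards[OF fg(1)] \<open>f ` H \<subseteq> pverts \<Gamma>\<close>
            finite_subset[OF _ pair_finite_verts] by simp
        ultimately show False using min by fastforce
      qed
      then have "card H \<le> 2"
        using minimal_bihomogeneous_overlap[OF pair_finite_verts bis[OF fg(1)] cards[OF fg(1)]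
            bis[OF fg(2)] cards[OF fg(2)] ov] by blast
      then show False using False ge2 by simp
    qed
    then show ?thesis using H unfolding bihomogeneous_block_def by blast
  qed
qed

section \<open>From a block to a wreath product\<close>

lemma digraph_isoI:
  assumes G: "pair_wf_digraph G" and H: "pair_wf_digraph H" and f: "bij_betw f (pverts G) (pverts H)"
    and arcs: "\<And>x y. x \<in> pverts G \<Longrightarrow> y \<in> pverts G \<Longrightarrow> (f x, f y) \<in> parcs H \<longleftrightarrow> (x, y) \<in> parcs G"
  shows "digraph_iso (with_proj G) (with_proj H)"
proof -
  interpret G: pair_wf_digraph G by fact
  interpret H: pair_wf_digraph H by fact
  have "parcs H = (\<lambda>(x, y). (f x, f y)) ` parcs G"
  proof (intro equalityI subsetI)
    fix e assume e: "e \<in> parcs H"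
    obtain u v where uv: "e = (u, v)" by fastforce
    then obtain x y where "x \<in> pverts G" "y \<in> pverts G" "u = f x" "v = f y"
      using e H.in_arcsD1 H.in_arcsD2 f unfolding bij_betw_def by blast
    then show "e \<in> (\<lambda>(x, y). (f x, f y)) ` parcs G"
      using e uv arcs by (intro rev_image_eqI[of "(x, y)"]) auto
  qed (use arcs G.in_arcsD1 G.in_arcsD2 in auto)
  then show ?thesis using G f by (auto simp: digraph_iso_with_proj_iff)
qed

text \<open>The translates of \<open>H\<close> partition the vertices. The first factor is the
  quotient by this partition, the second is the subdigraph induced on \<open>H\<close>. Inside a
  translate the edges are copied from \<open>H\<close> by an automorphism; between two translates
  there are all edges or none in a given direction.\<close>

lemma bihomogeneous_block_imp_wreath:
  assumes G: "pair_digraph \<Gamma>" and vt: "vertex_transitive \<Gamma>" and H: "bihomogeneous_block \<Gamma> H"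
  shows "isomorphic_to_nontrivial_wreath \<Gamma>"
proof -
  interpret pair_digraph \<Gamma> by fact
  have loops: "(z, z) \<notin> parcs \<Gamma>" for z using no_loops' by blast
  have bi: "bihomogeneous \<Gamma> H" and ge2: "card H \<ge> 2" and neq: "H \<noteq> pverts \<Gamma>"
    using H by (simp_all add: bihomogeneous_block_def nontrivial_bihomogeneous_def)
  have sub: "H \<subseteq> pverts \<Gamma>" using bi by (simp add: bihomogeneous_iff)
  have finH: "finite H" using sub pair_finite_verts finite_subset by blast
  define \<B> where "\<B> = {f ` H | f. automorphism \<Gamma> f}"
  have bih: "bihomogeneous \<Gamma> B" if "B \<in> \<B>" for B
    using that bihomogeneous_automorphism_image[OF _ bi] by (auto simp: \<B>_def)
  have Bsub: "B \<subseteq> pverts \<Gamma>" if "B \<in> \<B>" for B using bih[OF that] by (simp add: bihomogeneous_iff)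
  have disj: "B = C" if "B \<in> \<B>" "C \<in> \<B>" "x \<in> B" "x \<in> C" for B C x
    using that H unfolding bihomogeneous_block_def \<B>_def by blast
  obtain h0 where h0: "h0 \<in> H" using ge2 by fastforce
  have cover: "\<exists>B\<in>\<B>. x \<in> B" if x: "x \<in> pverts \<Gamma>" for x
  proof -
    obtain f where "automorphism \<Gamma> f" "f h0 = x"
      using vt x subsetD[OF sub h0] unfolding vertex_transitive_def by meson
    then show ?thesis using h0 unfolding \<B>_def by blast
  qed
  have finB: "finite \<B>"
    by (rule finite_subset[of _ "Pow (pverts \<Gamma>)"]) (use Bsub pair_finite_verts in auto)
  have "card \<B> \<ge> 2"
  proof -
    have H_eq: "card B = card H" if "B \<in> \<B>" for B
      using that automorphism_inj sub by (auto simp: \<B>_def intro!: card_image intro: inj_on_subset)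
    obtain B where B: "B \<in> \<B>" using cover h0 sub by blast
    \<comment> \<open>A translate has the size of the proper subset \<open>H\<close>, so some vertex
      is left over and lies in a second translate.\<close>
    have "B \<noteq> pverts \<Gamma>"
      using H_eq[OF B] neq sub pair_finite_verts by (metis card_subset_eq)
    then obtain x where x: "x \<in> pverts \<Gamma>" "x \<notin> B" using Bsub[OF B] by blast
    then obtain C where "C \<in> \<B>" "x \<in> C" using cover by blast
    then have "card {B, C} \<le> card \<B>" "B \<noteq> C" using finB B x by (auto intro!: card_mono)
    then show ?thesis by simp
  qed
  have "\<forall>B\<in>\<B>. \<exists>f. automorphism \<Gamma> f \<and> f ` H = B" by (auto simp: \<B>_def)
  \<comment> \<open>Each \<open>F B\<close> serves as a coordinate system on \<open>B\<close> with
    values from \<open>H\<close>. Any choice will do, because edges between distinct translates do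
    not depend on positions within them.\<close>
  then obtain F where F: "\<And>B. B \<in> \<B> \<Longrightarrow> automorphism \<Gamma> (F B)" "\<And>B. B \<in> \<B> \<Longrightarrow> F B ` H = B"
    by metis
  define \<Delta> where "\<Delta> = \<lparr> pverts = \<B>,
    parcs = {(B, C). B \<in> \<B> \<and> C \<in> \<B> \<and> B \<noteq> C \<and> (\<exists>b\<in>B. \<exists>c\<in>C. (b, c) \<in> parcs \<Gamma>)} \<rparr>"
  define \<Delta>' where "\<Delta>' = \<lparr> pverts = H, parcs = parcs \<Gamma> \<inter> H \<times> H \<rparr>"
  have \<Delta>: "pair_digraph \<Delta>"
  proof
    show "finite (parcs \<Delta>)"
      by (rule finite_subset[of _ "\<B> \<times> \<B>"]) (use finB in \<open>auto simp: \<Delta>_def\<close>)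
  qed (use finB in \<open>auto simp: \<Delta>_def\<close>)
  have \<Delta>': "pair_digraph \<Delta>'"
    by unfold_locales (use finH loops in \<open>auto simp: \<Delta>'_def\<close>)
  interpret W: pair_digraph "wreath \<Delta> \<Delta>'" using \<Delta> \<Delta>' by (rule pair_digraph_wreath)
  define k where "k = (\<lambda>(B, h). F B h)"
  have k_in: "F B h \<in> B" if "B \<in> \<B>" "h \<in> H" for B h using F(2) that by blast
  have "bij_betw k (\<B> \<times> H) (pverts \<Gamma>)"
  proof (rule bij_betw_imageI)
    show "inj_on k (\<B> \<times> H)"
    proof (rule inj_onI, clarify)
      fix B C h h' assume *: "B \<in> \<B>" "C \<in> \<B>" "h \<in> H" "h' \<in> H" "k (B, h) = k (C, h')"
      then have "B = C" using disj[of B C] k_in[of B h] k_in[of C h'] by (simp add: k_def)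
      then show "B = C \<and> h = h'"
        using * automorphism_inj[OF F(1)[of B]] sub by (auto simp: k_def dest: inj_onD)
    qed
    show "k ` (\<B> \<times> H) = pverts \<Gamma>"
    proof (intro equalityI subsetI)
      fix x assume "x \<in> k ` (\<B> \<times> H)"
      then show "x \<in> pverts \<Gamma>" using k_in Bsub by (auto simp: k_def)
    next
      fix x assume "x \<in> pverts \<Gamma>"
      then obtain B where B: "B \<in> \<B>" "x \<in> B" using cover by blast
      then obtain h where "h \<in> H" "x = F B h" using F(2) by blast
      then show "x \<in> k ` (\<B> \<times> H)" using B by (intro rev_image_eqI[of "(B, h)"]) (auto simp: k_def)
    qed
  qed
  moreover have "(k p, k q) \<in> parcs \<Gamma> \<longleftrightarrow> (p, q) \<in> parcs (wreath \<Delta> \<Delta>')"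
    if "p \<in> \<B> \<times> H" "q \<in> \<B> \<times> H" for p q
  proof -
    obtain B h C h' where pq: "p = (B, h)" "q = (C, h')" by fastforce
    have *: "B \<in> \<B>" "h \<in> H" "C \<in> \<B>" "h' \<in> H" using that pq by auto
    show ?thesis
    proof (cases "B = C")
      case True
      then show ?thesis
        using * automorphism_arc_iff[OF F(1), of B h h'] sub
        by (auto simp: pq k_def wreath_def \<Delta>_def \<Delta>'_def)
    next
      case False
      \<comment> \<open>The endpoints are moved one at a time: first \<open>c\<close> within
        \<open>C\<close>, seen from \<open>b\<close> outside \<open>C\<close>, then \<open>b\<close>
        within \<open>B\<close>, seen from \<open>F C h'\<close> outside \<open>B\<close>.\<close>
      have "(b, c) \<in> parcs \<Gamma> \<longleftrightarrow> (F B h, F C h') \<in> parcs \<Gamma>" if bc: "b \<in> B" "c \<in> C" for b c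
      proof -
        have "b \<notin> C" "F C h' \<notin> B" using False disj * bc k_in by blast+
        then have "(b, c) \<in> parcs \<Gamma> \<longleftrightarrow> (b, F C h') \<in> parcs \<Gamma>"
          and "(b, F C h') \<in> parcs \<Gamma> \<longleftrightarrow> (F B h, F C h') \<in> parcs \<Gamma>"
          using bihomogeneousD(1)[OF bih[OF *(3)], of b c "F C h'"]
            bihomogeneousD(2)[OF bih[OF *(1)], of "F C h'" b "F B h"] * bc k_in Bsub by blast+
        then show ?thesis by blast
      qed
      moreover have "F B h \<in> B" "F C h' \<in> C" using * k_in by blast+
      ultimately have "(\<exists>b\<in>B. \<exists>c\<in>C. (b, c) \<in> parcs \<Gamma>) \<longleftrightarrow> (F B h, F C h') \<in> parcs \<Gamma>" by blast
      then have "(B, C) \<in> parcs \<Delta> \<longleftrightarrow> (F B h, F C h') \<in> parcs \<Gamma>"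
        using False * by (simp add: \<Delta>_def)
      then show ?thesis using False * by (auto simp: pq k_def wreath_def \<Delta>_def \<Delta>'_def)
    qed
  qed
  moreover have "pverts (wreath \<Delta> \<Delta>') = \<B> \<times> H" by (simp add: wreath_def \<Delta>_def \<Delta>'_def)
  ultimately have "digraph_iso (with_proj (wreath \<Delta> \<Delta>')) (with_proj \<Gamma>)"
    using W.pair_wf_digraph pair_wf_digraph by (intro digraph_isoI[where f = k]) auto
  then have "digraph_iso (with_proj \<Gamma>) (with_proj (wreath \<Delta> \<Delta>'))"
    using digraph_iso_swap W.wf_digraph by blast
  then show ?thesis
    using isomorphic_to_nontrivial_wreathI[OF \<Delta> \<Delta>'] \<open>card \<B> \<ge> 2\<close> ge2
    by (simp add: \<Delta>_def \<Delta>'_def)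
qed

section \<open>From a wreath product to a bihomogeneous set\<close>

text \<open>The witness is a fibre of the first projection: an edge between different fibres depends
  only on the first coordinates of its ends.\<close>

lemma wreath_imp_nontrivial_bihomogeneous:
  assumes "pair_digraph \<Gamma>" "isomorphic_to_nontrivial_wreath \<Gamma>"
  shows "\<exists>H. nontrivial_bihomogeneous \<Gamma> H"
proof -
  interpret pair_digraph \<Gamma> by fact
  obtain \<Delta> \<Delta>' :: "nat pair_pre_digraph" where D: "pair_digraph \<Delta>" "pair_digraph \<Delta>'"
      "card (pverts \<Delta>) \<ge> 2" "card (pverts \<Delta>') \<ge> 2"
    and iso: "digraph_iso (with_proj \<Gamma>) (with_proj (wreath \<Delta> \<Delta>'))"
    using assms(2) unfolding isomorphic_to_nontrivial_wreath_def by blast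
  interpret A: pair_digraph \<Delta> by fact
  obtain f where f: "bij_betw f (pverts \<Gamma>) (pverts \<Delta> \<times> pverts \<Delta>')"
    and arcs: "parcs (wreath \<Delta> \<Delta>') = (\<lambda>(x, y). (f x, f y)) ` parcs \<Gamma>"
    using iso by (auto simp: digraph_iso_with_proj_iff wreath_def)
  have inj: "x = y" if "f x = f y" "x \<in> pverts \<Gamma>" "y \<in> pverts \<Gamma>" for x y
    using f that unfolding bij_betw_def by (meson inj_onD)
  have f_in: "f x \<in> pverts \<Delta> \<times> pverts \<Delta>'" if "x \<in> pverts \<Gamma>" for x
    using f that by (auto simp: bij_betw_def)
  \<comment> \<open>The isomorphism provides an equation of edge sets; injectivity of
    \<open>f\<close> on the vertices turns it into an equivalence for each pair.\<close>
  have arc: "(x, y) \<in> parcs \<Gamma> \<longleftrightarrow> (f x, f y) \<in> parcs (wreath \<Delta> \<Delta>')"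
    if "x \<in> pverts \<Gamma>" "y \<in> pverts \<Gamma>" for x y
  proof
    assume "(f x, f y) \<in> parcs (wreath \<Delta> \<Delta>')"
    then obtain u v where uv: "(u, v) \<in> parcs \<Gamma>" "f u = f x" "f v = f y"
      unfolding arcs by auto
    then have "u = x" "v = y" using inj that in_arcsD1 in_arcsD2 by blast+
    with uv show "(x, y) \<in> parcs \<Gamma>" by simp
  qed (auto simp: arcs)
  have out: "(x, y) \<in> parcs \<Gamma> \<longleftrightarrow> (fst (f x), fst (f y)) \<in> parcs \<Delta>"
    if "x \<in> pverts \<Gamma>" "y \<in> pverts \<Gamma>" "fst (f x) \<noteq> fst (f y)" for x y
    using arc[of x y] f_in[of x] f_in[of y] that
    by (cases "f x"; cases "f y") (auto simp: wreath_def)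
  \<comment> \<open>The fibre over \<open>a\<close> is the witness; a vertex over \<open>b\<close>
    shows that it is proper.\<close>
  obtain a b where ab: "a \<in> pverts \<Delta>" "b \<in> pverts \<Delta>" "a \<noteq> b"
    using D(3) A.pair_finite_verts by (metis card_le_Suc0_iff_eq not_less_eq_eq numeral_2_eq_2)
  define H where "H = {x\<in>pverts \<Gamma>. fst (f x) = a}"
  have "bihomogeneous \<Gamma> H"
    unfolding bihomogeneous_iff by (auto simp: H_def out)
  moreover have "f ` H = {a} \<times> pverts \<Delta>'"
  proof (intro equalityI subsetI)
    fix p assume "p \<in> {a} \<times> pverts \<Delta>'"
    then have p: "p \<in> f ` pverts \<Gamma>" "fst p = a" using f ab by (auto simp: bij_betw_def)
    then obtain x where "x \<in> pverts \<Gamma>" "p = f x" by blast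
    with p show "p \<in> f ` H" by (simp add: H_def)
  qed (use f_in in \<open>auto simp: H_def mem_Times_iff\<close>)
  then have "card H = card ({a} \<times> pverts \<Delta>')"
    by (metis (no_types, lifting) H_def card_image f bij_betw_def inj_on_subset mem_Collect_eq subsetI)
  moreover have "H \<noteq> pverts \<Gamma>"
  proof -
    obtain c where "c \<in> pverts \<Delta>'" using D(4) by fastforce
    then have "(b, c) \<in> f ` pverts \<Gamma>" using f ab by (simp add: bij_betw_def)
    then obtain x where x: "x \<in> pverts \<Gamma>" "f x = (b, c)" by force
    then have "x \<notin> H" using ab by (simp add: H_def)
    with x show ?thesis by blast
  qed
  ultimately show ?thesis
    using D(4) unfolding nontrivial_bihomogeneous_def by (auto simp: card_cartesian_product)
qed

theorem theorem3p7:
  fixes \<Gamma> :: "'a pair_pre_digraph"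
    and A :: "('g, 'm) monoid_scheme"
    and \<phi> :: "'g \<Rightarrow> 'a \<Rightarrow> 'a"
  assumes "pair_digraph \<Gamma>"
    and "acts_vertex_transitively A \<phi> \<Gamma>"
    and "\<not> complete_digraph (card (pverts \<Gamma>)) (with_proj \<Gamma>)"
    and "\<not> cocomplete \<Gamma>"
  shows "isomorphic_to_nontrivial_wreath \<Gamma> \<longleftrightarrow> (\<exists>H. nontrivial_bihomogeneous \<Gamma> H)"
  using assms wreath_imp_nontrivial_bihomogeneous bihomogeneous_block_imp_wreath
    bihomogeneous_block_exists vertex_transitiveI
  by metis

end
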